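(* Let $(X,d)\in \mathbf{UT}$ have at least two points, let $D(X)$ be the distance set of $(X,d)$, and let $C(X)$ be the center of distances of $(X,d)$. Then either $C(X)=\{0\}$ or $C(X)=\{0,\operatorname{diam} X\}$ and, moreover, the equality $C(X)=\{0,\operatorname{diam} X\}$ holds if and only if $\operatorname{diam} X\in D(X)$.
   Context: $\mathbb{R}^+=[0,+\infty)$. All metric spaces are non-empty. A metric space $(X,d)$ is ultrametric if $d(x,y)\le\max\{d(x,z),d(z,y)\}$ for all $x,y,z\in X$. The distance set is $D(X):=\{d(x,y): x,y\in X\}\subseteq\mathbb{R}^+$. The diameter is $\operatorname{diam} X:=\sup\{d(x,y):x,y\in X\}$, which may equal $+\infty$. The center of distances is $C(X):=\{t\in D(X): \forall p\in X\ \exists x\in X\ d(p,x)=t\}$. A tree is a connected (simple, undirected, possibly infinite, non-empty) graph without cycles. A labeled tree $T=T(l)$ is a tree $T$ with a labeling $l\colon V(T)\to\mathbb{R}^+$. The labeling is non-degenerate if $\max\{l(u),l(v)\}>0$ for every edge $\{u,v\}\in E(T)$. For a non-degenerate labeling, the function $d_l$ on $V(T)\times V(T)$ given by $d_l(u,u)=0$ and $d_l(u,v)=\max_{w\in V(P_{u,v})} l(w)$ for $u\ne v$, where $P_{u,v}$ is the (unique, finite) path in $T$ joining $u$ and $v$ (including its endpoints), is an ultrametric on $V(T)$. $\mathbf{UT}$ denotes the class of all ultrametric spaces isometric (via a bijective distance-preserving map) to $(V(T),d_l)$ for some labeled tree $T(l)$ with non-degenerate labeling. *)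

theory Defs
  imports "HOL-Analysis.Analysis"
begin

section \<open>Ultrametric spaces and distances\<close>

locale ultrametric_space = Metric_space M d for M :: "'a set" and d +
  assumes nonempty: "M \<noteq> {}"
    and ultrametric: "\<lbrakk>x \<in> M; y \<in> M; z \<in> M\<rbrakk> \<Longrightarrow> d x y \<le> max (d x z) (d z y)"

definition distance_set :: "'a set \<Rightarrow> ('a \<Rightarrow> 'a \<Rightarrow> real) \<Rightarrow> real set" where
  "distance_set X d = {d x y | x y. x \<in> X \<and> y \<in> X}"

text \<open>The diameter of an unbounded space is \<open>\<infinity>\<close>, hence the extended reals.\<close>

definition diam :: "'a set \<Rightarrow> ('a \<Rightarrow> 'a \<Rightarrow> real) \<Rightarrow> ereal" where
  "diam X d = (SUP t\<in>distance_set X d. ereal t)"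

definition center_of_distances :: "'a set \<Rightarrow> ('a \<Rightarrow> 'a \<Rightarrow> real) \<Rightarrow> real set" where
  "center_of_distances X d = {t \<in> distance_set X d. \<forall>p\<in>X. \<exists>x\<in>X. d p x = t}"


section \<open>Trees and labelings\<close>

text \<open>
  Simple undirected graphs, possibly infinite, with edges as two-element vertex sets.
  The notions \<open>tree\<close> and \<open>cycle\<close> of the entry Graph-Theory are not used here: they are
  notions for digraphs, where a pair of opposite arcs is already a cycle.
\<close>

definition simple_graph :: "'v set \<Rightarrow> 'v set set \<Rightarrow> bool" where
  "simple_graph V E \<longleftrightarrow> V \<noteq> {} \<and> (\<forall>e\<in>E. e \<subseteq> V \<and> card e = 2)"

text \<open>Paths and cycles are given by their lists of pairwise distinct vertices.\<close>

definition path_between :: "'v set \<Rightarrow> 'v set set \<Rightarrow> 'v \<Rightarrow> 'v list \<Rightarrow> 'v \<Rightarrow> bool" where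
  "path_between V E u p v \<longleftrightarrow>
     p \<noteq> [] \<and> set p \<subseteq> V \<and> hd p = u \<and> last p = v \<and> distinct p \<and>
     successively (\<lambda>x y. {x, y} \<in> E) p"

definition connected_graph :: "'v set \<Rightarrow> 'v set set \<Rightarrow> bool" where
  "connected_graph V E \<longleftrightarrow> (\<forall>u\<in>V. \<forall>v\<in>V. \<exists>p. path_between V E u p v)"

definition graph_cycle :: "'v set \<Rightarrow> 'v set set \<Rightarrow> 'v list \<Rightarrow> bool" where
  "graph_cycle V E p \<longleftrightarrow>
     length p \<ge> 3 \<and> set p \<subseteq> V \<and> distinct p \<and>
     successively (\<lambda>x y. {x, y} \<in> E) p \<and> {last p, hd p} \<in> E"

definition is_tree :: "'v set \<Rightarrow> 'v set set \<Rightarrow> bool" where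
  "is_tree V E \<longleftrightarrow> simple_graph V E \<and> connected_graph V E \<and> \<not> (\<exists>p. graph_cycle V E p)"

definition labeled_tree :: "'v set \<Rightarrow> 'v set set \<Rightarrow> ('v \<Rightarrow> real) \<Rightarrow> bool" where
  "labeled_tree V E l \<longleftrightarrow> is_tree V E \<and> (\<forall>v\<in>V. 0 \<le> l v)"

definition nondegenerate_labeling :: "'v set set \<Rightarrow> ('v \<Rightarrow> real) \<Rightarrow> bool" where
  "nondegenerate_labeling E l \<longleftrightarrow> (\<forall>u v. {u, v} \<in> E \<longrightarrow> max (l u) (l v) > 0)"

text \<open>The path \<open>THE p. \<dots>\<close> is well defined for vertices \<open>u\<close> and \<open>v\<close> of a tree.\<close>

definition tree_dist ::
  "'v set \<Rightarrow> 'v set set \<Rightarrow> ('v \<Rightarrow> real) \<Rightarrow> 'v \<Rightarrow> 'v \<Rightarrow> real" where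
  "tree_dist V E l u v =
     (if u = v then 0 else Max (l ` set (THE p. path_between V E u p v)))"


section \<open>The class of ultrametric spaces generated by labeled trees\<close>

definition isometric_spaces ::
  "'a set \<Rightarrow> ('a \<Rightarrow> 'a \<Rightarrow> real) \<Rightarrow> 'b set \<Rightarrow> ('b \<Rightarrow> 'b \<Rightarrow> real) \<Rightarrow> bool" where
  "isometric_spaces X d Y e \<longleftrightarrow>
     (\<exists>f. bij_betw f X Y \<and> (\<forall>x\<in>X. \<forall>y\<in>X. e (f x) (f y) = d x y))"

text \<open>
  The type argument is the type of the vertices of the generating trees. It cannot be
  quantified inside the definition; results about \<open>UT TYPE('v)\<close> are polymorphic in \<open>'v\<close>.
\<close>

definition UT :: "'v itself \<Rightarrow> ('a set \<times> ('a \<Rightarrow> 'a \<Rightarrow> real)) set" where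
  "UT (ty :: 'v itself) =
     {(X, d). ultrametric_space X d \<and>
        (\<exists>(V :: 'v set) E l. labeled_tree V E l \<and> nondegenerate_labeling E l \<and>
           isometric_spaces X d V (tree_dist V E l))}"

end

(*
  On the path between u and v the distance of u and v is attained as the label of a
  vertex w, and every distance from w is at least the label of w.  So for every pair of
  points there is a point all of whose nonzero distances are at least the distance of
  the pair.  Hence a positive t in the center of distances is an upper bound of the
  distance set; and if the diameter is the distance of some pair, then every nonzero
  distance from the corresponding w equals the diameter.
*)
theory Submission
  imports Defs
begin

text \<open>Peels off the first edge for the induction behind \<open>path_between_unique\<close>;
  two explicit leading vertices guarantee that there is an edge to peel.\<close>

lemma path_between_step:
  "path_between V E u (u # a # p) v \<longleftrightarrow>
     u \<in> V \<and> u \<notin> set (a # p) \<and> {u, a} \<in> E \<and> path_between V E a (a # p) v"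
  by (auto simp: path_between_def)

lemma path_between_ConsE:
  assumes "path_between V E u p v"
  obtains p' where "p = u # p'"
  using assms by (cases p) (auto simp: path_between_def)

lemma path_between_same:
  assumes "path_between V E u p u"
  shows "p = [u]"
proof -
  obtain p' where "p = u # p'" using assms by (rule path_between_ConsE)
  then show ?thesis using assms by (cases "p' = []") (auto simp: path_between_def)
qed

text \<open>Let \<open>w\<close> be the first vertex after \<open>u\<close> on the first path that
  also lies on the second. Up to \<open>w\<close> the two paths share only \<open>u\<close> and
  \<open>w\<close>, so going out along one and back along the other is a cycle.\<close>

lemma cycle_of_diverging_paths:
  assumes "path_between V E u (u # a # p) v" "path_between V E u (u # b # q) v" "a \<noteq> b"
  shows "\<exists>c. graph_cycle V E c"
proof -
  have "v \<in> set (a # p)" "v \<in> set (b # q)"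
    using assms(1,2) last_in_set[of "a # p"] last_in_set[of "b # q"]
    by (auto simp: path_between_def simp del: list.set)
  then obtain p1 w p2 where p: "a # p = p1 @ w # p2" and w: "w \<in> set (b # q)"
      and p1: "\<forall>x\<in>set p1. x \<notin> set (b # q)"
    using split_list_first_prop[of "a # p" "\<lambda>x. x \<in> set (b # q)"] by blast
  obtain q1 q2 where q: "b # q = q1 @ w # q2"
    using w by (meson split_list)
  \<comment> \<open>If both segments were empty, then \<open>a = w = b\<close>. One inner vertex
    besides \<open>u\<close> and \<open>w\<close> gives the cycle its minimal length 3.\<close>
  have "p1 \<noteq> [] \<or> q1 \<noteq> []" using p q \<open>a \<noteq> b\<close> by auto
  then have len: "length (u # p1 @ w # rev q1) \<ge> 3"
    by (cases p1; cases q1) auto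
  have P: "path_between V E u (u # p1 @ w # p2) v"
    and Q: "path_between V E u (u # q1 @ w # q2) v"
    using assms(1,2) p q by auto
  have disj: "set p1 \<inter> set q1 = {}" using p1 q by auto
  have V: "set (u # p1 @ w # rev q1) \<subseteq> V"
    using P Q by (auto simp: path_between_def)
  have dist: "distinct (u # p1 @ w # rev q1)"
    using P Q disj by (auto simp: path_between_def)
  let ?R = "\<lambda>x y. {x, y} \<in> E"
  have "successively ?R ((u # p1 @ [w]) @ p2)" "successively ?R (u # (q1 @ [w]) @ q2)"
    using P Q by (auto simp: path_between_def)
  then have s1: "successively ?R (u # p1 @ [w])" and s2: "successively ?R (u # q1 @ [w])"
    by (auto simp: successively_append_iff successively_Cons hd_append split: if_splits)
  have s3: "successively ?R (rev (q1 @ [w]))"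
    using s2 by (subst successively_rev) (auto simp: successively_Cons insert_commute)
  have "successively ?R ((u # p1 @ [w]) @ rev q1)"
    using s1 s3 by (auto simp: successively_append_iff successively_Cons hd_append)
  \<comment> \<open>The closing edge is the first edge of the second path: the last vertex is the
    head of \<open>q1\<close>, or \<open>w\<close> if \<open>q1\<close> is empty.\<close>
  moreover have "{last (u # p1 @ w # rev q1), u} \<in> E"
    using s2 by (cases q1) (auto simp: successively_Cons insert_commute)
  ultimately have "graph_cycle V E (u # p1 @ w # rev q1)"
    using len V dist by (simp add: graph_cycle_def)
  then show ?thesis by blast
qed

text \<open>Induction along the first path: without cycles the second vertices of the two paths
  agree, and the tails are again paths to \<open>v\<close>.\<close>

lemma path_between_unique:
  assumes "\<nexists>c. graph_cycle V E c" "path_between V E u p v" "path_between V E u q v"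
  shows "p = q"
  using assms(2,3)
proof (induction p arbitrary: u q)
  case Nil
  then show ?case by (simp add: path_between_def)
next
  case (Cons x p)
  have x: "x = u" using Cons.prems(1) by (simp add: path_between_def)
  obtain q' where q: "q = u # q'" using Cons.prems(2) by (rule path_between_ConsE)
  show ?case
  proof (cases "u = v")
    case True
    then show ?thesis using Cons.prems path_between_same by metis
  next
    case False
    then obtain a p'' b q'' where pq: "p = a # p''" "q' = b # q''"
      using Cons.prems q x by (cases p; cases q') (auto simp: path_between_def)
    have P: "path_between V E u (u # a # p'') v" and Q: "path_between V E u (u # b # q'') v"
      using Cons.prems x q pq by auto
    then have "a = b" using cycle_of_diverging_paths assms(1) by metis
    then show ?thesis
      using Cons.IH[of a q'] P Q x q pq by (simp add: path_between_step)
  qed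
qed

text \<open>Uniqueness of paths resolves the \<open>THE\<close> in \<open>tree_dist\<close>, so that
  later arguments work with an actual path.\<close>

lemma tree_dist_path:
  assumes "is_tree V E" "u \<in> V" "v \<in> V" "u \<noteq> v"
  obtains p where "path_between V E u p v" "tree_dist V E l u v = Max (l ` set p)"
proof -
  obtain p where p: "path_between V E u p v"
    using assms(1-3) unfolding is_tree_def connected_graph_def by blast
  moreover have "(THE p. path_between V E u p v) = p"
    using p
  proof (rule the_equality)
    show "q = p" if "path_between V E u q v" for q
      using assms(1) that p by (intro path_between_unique) (auto simp: is_tree_def)
  qed
  ultimately show thesis using that assms(4) by (simp add: tree_dist_def)
qed

lemma tree_dist_attained:
  assumes "is_tree V E" "u \<in> V" "v \<in> V" "u \<noteq> v"
  shows "\<exists>w\<in>V. tree_dist V E l u v = l w"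
proof -
  obtain p where p: "path_between V E u p v" "tree_dist V E l u v = Max (l ` set p)"
    using assms by (rule tree_dist_path)
  then have "p \<noteq> []" "set p \<subseteq> V" by (auto simp: path_between_def)
  moreover from this have "Max (l ` set p) \<in> l ` set p" by (intro Max_in) auto
  ultimately show ?thesis unfolding p(2) by blast
qed

lemma label_le_tree_dist:
  assumes "is_tree V E" "u \<in> V" "v \<in> V" "u \<noteq> v"
  shows "l u \<le> tree_dist V E l u v"
proof -
  obtain p where p: "path_between V E u p v" "tree_dist V E l u v = Max (l ` set p)"
    using assms by (rule tree_dist_path)
  then have "u \<in> set p" by (auto simp: path_between_def)
  then show ?thesis using p by simp
qed

text \<open>The point \<open>w\<close> corresponds to a vertex of maximal label on the path joining
  \<open>f x\<close> and \<open>f y\<close>. That label equals \<open>d x y\<close> and bounds every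
  nonzero distance from \<open>w\<close> from below. Trees do not occur after this lemma.\<close>

lemma UT_remote_point:
  assumes "(X, d) \<in> UT TYPE('v)" "x \<in> X" "y \<in> X" "x \<noteq> y"
  obtains w where "w \<in> X" "\<And>p. p \<in> X \<Longrightarrow> p \<noteq> w \<Longrightarrow> d x y \<le> d w p"
proof -
  obtain V :: "'v set" and E l f where tree: "is_tree V E"
    and bij: "bij_betw f X V"
    and iso: "\<And>x y. x \<in> X \<Longrightarrow> y \<in> X \<Longrightarrow> tree_dist V E l (f x) (f y) = d x y"
    using assms(1) unfolding UT_def labeled_tree_def isometric_spaces_def by blast
  have V: "f z \<in> V" if "z \<in> X" for z using bij that by (auto simp: bij_betw_def)
  have inj: "f z \<noteq> f z'" if "z \<in> X" "z' \<in> X" "z \<noteq> z'" for z z'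
    using bij that by (auto simp: bij_betw_def inj_on_def)
  obtain w where w: "w \<in> X" "d x y = l (f w)"
    using tree_dist_attained[OF tree V V inj, of x y l] iso[of x y] assms(2-4) bij
    by (auto simp: bij_betw_def)
  show thesis
  proof (rule that[OF w(1)])
    fix p assume "p \<in> X" "p \<noteq> w"
    then show "d x y \<le> d w p"
      using label_le_tree_dist[OF tree V V inj, of w p l] iso[of w p] w by simp
  qed
qed

text \<open>Replaces the extended real supremum by real inequalities when the candidate value is
  itself a distance.\<close>

lemma diam_eq_iff:
  assumes "t \<in> distance_set X d"
  shows "diam X d = ereal t \<longleftrightarrow> (\<forall>s\<in>distance_set X d. s \<le> t)"
proof
  assume "diam X d = ereal t"
  then show "\<forall>s\<in>distance_set X d. s \<le> t"
    by (metis SUP_upper diam_def ereal_less_eq(3))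
next
  assume "\<forall>s\<in>distance_set X d. s \<le> t"
  then show "diam X d = ereal t"
    unfolding diam_def using assms by (intro antisym SUP_least SUP_upper) auto
qed

theorem theorem4:
  fixes X :: "'a set" and d :: "'a \<Rightarrow> 'a \<Rightarrow> real"
  assumes "(X, d) \<in> UT TYPE('v)"
    and "\<exists>x\<in>X. \<exists>y\<in>X. x \<noteq> y"
  shows "(center_of_distances X d = {0} \<or>
          ereal ` center_of_distances X d = {0, diam X d}) \<and>
         (ereal ` center_of_distances X d = {0, diam X d} \<longleftrightarrow>
          diam X d \<in> ereal ` distance_set X d)"
proof -
  let ?C = "center_of_distances X d" and ?D = "distance_set X d"
  interpret ultrametric_space X d using assms(1) by (simp add: UT_def)
  obtain a b where ab: "a \<in> X" "b \<in> X" "a \<noteq> b" using assms(2) by blast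
  have CD: "?C \<subseteq> ?D" by (auto simp: center_of_distances_def)
  have refl: "d x x = 0" if "x \<in> X" for x using that by simp
  then have "0 \<in> ?D" using ab(1) by (force simp: distance_set_def)
  then have zero: "0 \<in> ?C" using refl by (auto simp: center_of_distances_def)
  have center: "diam X d = ereal t" if t: "t \<in> ?C" "t \<noteq> 0" for t
  proof -
    have tD: "t \<in> ?D" using t CD by blast
    then have "t \<ge> 0" by (auto simp: distance_set_def)
    have "d x y \<le> t" if xy: "x \<in> X" "y \<in> X" for x y
    proof (cases "x = y")
      case True
      then show ?thesis using xy \<open>t \<ge> 0\<close> by simp
    next
      case False
      obtain w where w: "w \<in> X" "\<And>p. p \<in> X \<Longrightarrow> p \<noteq> w \<Longrightarrow> d x y \<le> d w p"
        using UT_remote_point[OF assms(1) xy False] by blast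
      obtain z where z: "z \<in> X" "d w z = t"
        using t(1) w(1) by (auto simp: center_of_distances_def)
      \<comment> \<open>Since \<open>t\<close> is nonzero, it is a distance from \<open>w\<close> to
        another point, so the lower bound at \<open>w\<close> applies to it.\<close>
      then have "z \<noteq> w" using t(2) w(1) by auto
      then show ?thesis using w(2) z by auto
    qed
    then show ?thesis using diam_eq_iff[OF tD] by (auto simp: distance_set_def)
  qed
  have attained: "m \<in> ?C \<and> m \<noteq> 0" if m: "m \<in> ?D" "diam X d = ereal m" for m
  proof -
    have le: "d x y \<le> m" if "x \<in> X" "y \<in> X" for x y
      using m that diam_eq_iff[OF m(1)] by (auto simp: distance_set_def)
    \<comment> \<open>The two distinct points make the diameter positive, so the pair realizing
      \<open>m\<close> consists of distinct points.\<close>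
    have "0 < d a b" using ab by simp
    then have "0 < m" using le[OF ab(1,2)] by linarith
    obtain x y where xy: "x \<in> X" "y \<in> X" "d x y = m" using m(1) by (auto simp: distance_set_def)
    then have "x \<noteq> y" using \<open>0 < m\<close> by auto
    then obtain w where w: "w \<in> X" "\<And>p. p \<in> X \<Longrightarrow> p \<noteq> w \<Longrightarrow> m \<le> d w p"
      using UT_remote_point[OF assms(1) xy(1,2)] xy(3) by blast
    have w_eq: "d w p = m" if "p \<in> X" "p \<noteq> w" for p
      using w le that by (meson antisym)
    \<comment> \<open>Every point other than \<open>w\<close> has \<open>w\<close> itself at
      distance \<open>m\<close>; for \<open>w\<close>, one of the distinct points \<open>a\<close>
      and \<open>b\<close> serves.\<close>
    have "\<exists>z\<in>X. d p z = m" if "p \<in> X" for p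
    proof (cases "p = w")
      case True
      then show ?thesis using w_eq ab by metis
    next
      case False
      then show ?thesis using w_eq w(1) that commute by metis
    qed
    then show ?thesis using m(1) \<open>0 < m\<close> by (simp add: center_of_distances_def)
  qed
  show ?thesis
  proof (cases "diam X d \<in> ereal ` ?D")
    case True
    then obtain m where m: "m \<in> ?D" "diam X d = ereal m" by auto
    \<comment> \<open>By \<open>center\<close>, a nonzero member of the center equals the diameter,
      hence \<open>m\<close>.\<close>
    have "?C = {0, m}" using attained[OF m] zero center m(2) by auto
    then show ?thesis using True m(2) by (simp add: zero_ereal_def)
  next
    case False
    \<comment> \<open>A nonzero \<open>t\<close> in the center would be a distance equal to the
      diameter.\<close>
    have "t = 0" if "t \<in> ?C" for t
      using center[of t] that CD False by blast
    then have "?C = {0}" using zero by blast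
    \<comment> \<open>Equality would put the diameter into the image of the center, and so among the
      distances.\<close>
    moreover have "ereal ` ?C \<noteq> {0, diam X d}" using False CD by blast
    ultimately show ?thesis using False by simp
  qed
qed

end
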